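(* There is no stepsize schedule $\boldsymbol{\eta}=(\eta_k)_{k\in\mathbb{N}}\in(0,\infty)^{\mathbb{N}}$ such that $G_n(\boldsymbol{\eta})=o(n^{-1})$ as $n\to\infty$, i.e. such that $\lim_{n\to\infty} n\,G_n(\boldsymbol{\eta})=0$.
   Context: $\mathbb{N}=\{1,2,3,\ldots\}$, $\|\cdot\|$ is the $\ell_2$-norm. A differentiable function $f:\mathbb{R}^d\to\mathbb{R}$ is $1$-smooth if $\|\nabla f(x)-\nabla f(y)\|\le\|x-y\|$ for all $x,y\in\mathbb{R}^d$. Let $\mathscr{F}_1(\mathbb{R}^d)$ be the class of convex $1$-smooth functions $f:\mathbb{R}^d\to\mathbb{R}$ whose set of minimizers $X_f^\star=\arg\min_{x\in\mathbb{R}^d}f(x)$ is nonempty. Given a stepsize schedule $\boldsymbol{\eta}=(\eta_k)_{k\in\mathbb{N}}$ (a fixed sequence of positive numbers, not depending on $f$, the initial point or $n$), gradient descent (GD) on $f$ from $x_1\in\mathbb{R}^d$ generates $x_{k+1}=x_k-\eta_k\nabla f(x_k)$ for all $k\in\mathbb{N}$. The worst-case rate is $$G_n(\boldsymbol{\eta})=\sup_{d\in\mathbb{N}}\ \sup_{f\in\mathscr{F}_1(\mathbb{R}^d)}\ \sup_{x^\star\in X_f^\star}\ \sup_{x_1\in\mathbb{R}^d\setminus X_f^\star}\frac{\frac12\|\nabla f(x_{n+1})\|^2}{f(x_1)-f(x^\star)},$$ where $x_{n+1}$ is the GD iterate after $n$ steps on $f$ started at $x_1$. *)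

theory Defs
  imports "HOL-Analysis.Analysis"
begin

text \<open>
  The dimension \<open>d\<close> is quantified inside the worst-case rate, so it cannot be a type.
  As in \<^const>\<open>Euclidean_space\<close>, a vector of \<open>\<real>\<^sup>d\<close> is a function \<open>x :: nat \<Rightarrow> real\<close> with
  coordinates \<open>x 0, \<dots>, x (d - 1)\<close> and \<open>x i = 0\<close> for \<open>i \<ge> d\<close>.  A function
  \<open>\<real>\<^sup>d \<rightarrow> \<real>\<close> is an \<open>f :: (nat \<Rightarrow> real) \<Rightarrow> real\<close> of which only the values on this carrier matter.
\<close>

abbreviation Rd :: "nat \<Rightarrow> (nat \<Rightarrow> real) set" where
  "Rd d \<equiv> topspace (Euclidean_space d)"

definition inner_d :: "nat \<Rightarrow> (nat \<Rightarrow> real) \<Rightarrow> (nat \<Rightarrow> real) \<Rightarrow> real" where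
  "inner_d d x y = (\<Sum>i<d. x i * y i)"

abbreviation norm_d :: "nat \<Rightarrow> (nat \<Rightarrow> real) \<Rightarrow> real" where
  "norm_d d x \<equiv> L2_set x {..<d}"

abbreviation minus_d :: "(nat \<Rightarrow> real) \<Rightarrow> (nat \<Rightarrow> real) \<Rightarrow> (nat \<Rightarrow> real)" where
  "minus_d x y \<equiv> (\<lambda>i. x i - y i)"

text \<open>Frechet differentiability at \<open>x\<close>, the derivative being \<open>h \<mapsto> \<langle>g, h\<rangle>\<close>.\<close>

definition has_gradient ::
    "nat \<Rightarrow> ((nat \<Rightarrow> real) \<Rightarrow> real) \<Rightarrow> (nat \<Rightarrow> real) \<Rightarrow> (nat \<Rightarrow> real) \<Rightarrow> bool" where
  "has_gradient d f g x \<longleftrightarrow> g \<in> Rd d \<and>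
     (\<forall>\<epsilon>>0. \<exists>\<delta>>0. \<forall>y\<in>Rd d. norm_d d (minus_d y x) < \<delta> \<longrightarrow>
        \<bar>f y - f x - inner_d d g (minus_d y x)\<bar> \<le> \<epsilon> * norm_d d (minus_d y x))"

definition gradient :: "nat \<Rightarrow> ((nat \<Rightarrow> real) \<Rightarrow> real) \<Rightarrow> (nat \<Rightarrow> real) \<Rightarrow> (nat \<Rightarrow> real)" where
  "gradient d f x = (THE g. has_gradient d f g x)"

lemma has_gradient_unique:
  assumes x: "x \<in> Rd d" and g: "has_gradient d f g x" and g': "has_gradient d f g' x"
  shows "g = g'"
proof -
  define w where "w = minus_d g g'"
  define N where "N = norm_d d w"
  have Rd: "g \<in> Rd d" "g' \<in> Rd d"
    using g g' by (auto simp: has_gradient_def)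
  have N0: "N \<ge> 0"
    by (simp add: N_def)
  have ww: "inner_d d w w = N\<^sup>2"
    by (simp add: inner_d_def N_def L2_set_def power2_eq_square sum_nonneg)
  have "N \<le> 0"
  proof (rule ccontr)
    assume "\<not> N \<le> 0"
    then have Np: "N > 0" by simp
    then have "N / 4 > 0" by simp
    from g this obtain d1 where d1: "d1 > 0"
      and D1: "\<forall>y\<in>Rd d. norm_d d (minus_d y x) < d1 \<longrightarrow>
        \<bar>f y - f x - inner_d d g (minus_d y x)\<bar> \<le> N / 4 * norm_d d (minus_d y x)"
      unfolding has_gradient_def by blast
    from g' \<open>N / 4 > 0\<close> obtain d2 where d2: "d2 > 0"
      and D2: "\<forall>y\<in>Rd d. norm_d d (minus_d y x) < d2 \<longrightarrow>
        \<bar>f y - f x - inner_d d g' (minus_d y x)\<bar> \<le> N / 4 * norm_d d (minus_d y x)"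
      unfolding has_gradient_def by blast
    define t where "t = min d1 d2 / (2 * N)"
    have t0: "t > 0" using d1 d2 Np by (simp add: t_def)
    have tN: "t * N < d1" "t * N < d2" using d1 d2 Np by (auto simp: t_def min_def)
    define y where "y = (\<lambda>i. x i + t * w i)"
    have y: "y \<in> Rd d"
      using x Rd by (simp add: y_def w_def topspace_Euclidean_space)
    have yx: "minus_d y x = (\<lambda>i. t * w i)"
      by (simp add: y_def)
    have nyx: "norm_d d (minus_d y x) = t * N"
      using t0 by (simp add: yx N_def L2_set_right_distrib)
    have "inner_d d g (minus_d y x) - inner_d d g' (minus_d y x) = t * inner_d d w w"
      unfolding yx inner_d_def w_def sum_distrib_left sum_subtractf[symmetric]
      by (intro sum.cong refl) (simp add: algebra_simps)
    moreover have "\<bar>f y - f x - inner_d d g (minus_d y x)\<bar> \<le> N / 4 * (t * N)"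
      and "\<bar>f y - f x - inner_d d g' (minus_d y x)\<bar> \<le> N / 4 * (t * N)"
      using D1[rule_format, OF y] D2[rule_format, OF y] tN unfolding nyx by blast+
    ultimately have "t * N\<^sup>2 \<le> N / 4 * (t * N) + N / 4 * (t * N)"
      unfolding ww by linarith
    then have "t * N\<^sup>2 \<le> t * N\<^sup>2 / 2"
      by (simp add: power2_eq_square field_simps)
    moreover have "t * N\<^sup>2 > 0" using t0 Np by simp
    ultimately show False by linarith
  qed
  then have "L2_set w {..<d} = 0" using N0 unfolding N_def by (rule antisym)
  then have w0: "w i = 0" if "i < d" for i
    using that by (simp add: L2_set_eq_0_iff)
  show ?thesis
  proof
    fix i
    show "g i = g' i"
    proof (cases "i < d")
      case True
      from w0[OF True] show ?thesis by (simp add: w_def)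
    next
      case False
      then show ?thesis using Rd by (simp add: topspace_Euclidean_space)
    qed
  qed
qed

lemma gradient_eqI: "x \<in> Rd d \<Longrightarrow> has_gradient d f g x \<Longrightarrow> gradient d f x = g"
  unfolding gradient_def by (rule the_equality, assumption) (rule has_gradient_unique)

definition minimizers :: "nat \<Rightarrow> ((nat \<Rightarrow> real) \<Rightarrow> real) \<Rightarrow> (nat \<Rightarrow> real) set" where
  "minimizers d f = {x. is_arg_min f (\<lambda>x. x \<in> Rd d) x}"

definition convex_d :: "nat \<Rightarrow> ((nat \<Rightarrow> real) \<Rightarrow> real) \<Rightarrow> bool" where
  "convex_d d f \<longleftrightarrow> (\<forall>x\<in>Rd d. \<forall>y\<in>Rd d. \<forall>t\<in>{0..1}.
     f (\<lambda>i. (1 - t) * x i + t * y i) \<le> (1 - t) * f x + t * f y)"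

definition one_smooth :: "nat \<Rightarrow> ((nat \<Rightarrow> real) \<Rightarrow> real) \<Rightarrow> bool" where
  "one_smooth d f \<longleftrightarrow> (\<forall>x\<in>Rd d. \<exists>g. has_gradient d f g x) \<and>
     (\<forall>x\<in>Rd d. \<forall>y\<in>Rd d.
        norm_d d (minus_d (gradient d f x) (gradient d f y)) \<le> norm_d d (minus_d x y))"

definition F1 :: "nat \<Rightarrow> ((nat \<Rightarrow> real) \<Rightarrow> real) set" where
  "F1 d = {f. convex_d d f \<and> one_smooth d f \<and> minimizers d f \<noteq> {}}"

text \<open>
  \<open>gd d f \<eta> x\<^sub>1 n\<close> is the iterate after \<open>n\<close> steps, written \<open>x\<^sub>n\<^sub>+\<^sub>1\<close> in the usual 1-based
  numbering.  The stepsizes are \<open>\<eta> 1, \<eta> 2, \<dots>\<close>; the value \<open>\<eta> 0\<close> is never used.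
\<close>

primrec gd :: "nat \<Rightarrow> ((nat \<Rightarrow> real) \<Rightarrow> real) \<Rightarrow> (nat \<Rightarrow> real) \<Rightarrow> (nat \<Rightarrow> real) \<Rightarrow> nat \<Rightarrow> (nat \<Rightarrow> real)" where
  "gd d f \<eta> x1 0 = x1"
| "gd d f \<eta> x1 (Suc n) =
     minus_d (gd d f \<eta> x1 n) (\<lambda>i. \<eta> (Suc n) * gradient d f (gd d f \<eta> x1 n) i)"

text \<open>
  The suprema are taken in the extended reals.  An inner supremum over an empty set (which
  occurs for constant \<open>f\<close>) is \<open>-\<infinity>\<close> and so does not affect the outer ones.
\<close>

definition worst_case_rate :: "(nat \<Rightarrow> real) \<Rightarrow> nat \<Rightarrow> ereal" where
  "worst_case_rate \<eta> n =
     (SUP d\<in>{1..}. SUP f\<in>F1 d. SUP xs\<in>minimizers d f. SUP x1\<in>Rd d - minimizers d f.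
        ereal ((1/2 * (norm_d d (gradient d f (gd d f \<eta> x1 n)))\<^sup>2) / (f x1 - f xs)))"

end

theory Submission
  imports Defs
begin

text \<open>
  Write \<open>S\<^sub>n = \<eta>\<^sub>1 + \<dots> + \<eta>\<^sub>n\<close>.  The one-sided Huber function in dimension one (quadratic up to
  \<open>1\<close>, then of slope \<open>1\<close>) has gradient \<open>1\<close> along the first \<open>n\<close> steps of GD from \<open>1 + S\<^sub>n\<close>, and
  these steps end exactly at the kink \<open>1\<close>; one more step overshoots to \<open>1 - \<eta>\<^sub>n\<^sub>+\<^sub>1\<close>.  Hence
  \<open>G\<^sub>n \<ge> 1 / (2 S\<^sub>n + 1)\<close> and \<open>G\<^sub>n\<^sub>+\<^sub>1 \<ge> (1 - \<eta>\<^sub>n\<^sub>+\<^sub>1)\<^sup>2 / (2 S\<^sub>n + 1)\<close>.  If \<open>n G\<^sub>n \<longlonglongrightarrow> 0\<close>, the first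
  bound forces the averages \<open>S\<^sub>n / n\<close> to infinity, while the second bounds \<open>\<eta>\<^sub>n\<^sub>+\<^sub>1\<close> by
  the order of \<open>sqrt (S\<^sub>n / n)\<close>, hence by \<open>S\<^sub>n / n\<close>, so that the averages eventually decrease.
\<close>

definition huber :: "real \<Rightarrow> real" where
  "huber t = (if t \<le> 1 then t\<^sup>2 / 2 else t - 1/2)"

lemma huber_nonneg: "huber t \<ge> 0"
  by (simp add: huber_def)

text \<open>The slope of \<open>huber\<close> at \<open>x\<close> is \<open>min x 1\<close>. When at
  least one point lies in the quadratic branch, the gap is half a square, plus
  \<open>(1 - x) * (y - 1)\<close> if \<open>x\<close> is below the kink and \<open>y\<close> above
  it.\<close>

lemma huber_above_tangent: "huber x + min x 1 * (y - x) \<le> huber y"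
proof (cases "x \<le> 1"; cases "y \<le> 1")
  assume "x \<le> 1" "y \<le> 1"
  moreover have "(y - x)\<^sup>2 \<ge> 0" by simp
  ultimately show ?thesis by (simp add: huber_def power2_eq_square field_simps)
next
  assume "x \<le> 1" "\<not> y \<le> 1"
  moreover from this have "(1 - x) * (y - 1) \<ge> 0" by simp
  moreover have "(x - 1)\<^sup>2 \<ge> 0" by simp
  ultimately show ?thesis by (simp add: huber_def power2_eq_square field_simps)
next
  assume "\<not> x \<le> 1" "y \<le> 1"
  moreover have "(y - 1)\<^sup>2 \<ge> 0" by simp
  ultimately show ?thesis by (simp add: huber_def power2_eq_square field_simps)
qed (simp add: huber_def)

text \<open>The tangent inequality with \<open>x\<close> and \<open>y\<close> exchanged bounds the
  gap by the change of slope times \<open>y - x\<close>, and \<open>min _ 1\<close> is 1-Lipschitz.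
  The constant is not sharp, but a quadratic error is all that differentiability requires.\<close>

lemma huber_below_parabola: "huber y - huber x - min x 1 * (y - x) \<le> (y - x)\<^sup>2"
proof -
  have "huber x + min y 1 * (y - x) \<ge> huber y"
    using huber_above_tangent[of y x] by (simp add: algebra_simps)
  moreover have "(min y 1 - min x 1) * (y - x) \<le> \<bar>min y 1 - min x 1\<bar> * \<bar>y - x\<bar>"
    by (metis abs_ge_self abs_mult)
  moreover have "\<bar>min y 1 - min x 1\<bar> * \<bar>y - x\<bar> \<le> \<bar>y - x\<bar> * \<bar>y - x\<bar>"
    by (rule mult_right_mono) auto
  ultimately show ?thesis
    by (simp add: power2_eq_square algebra_simps)
qed

abbreviation huber_grad :: "(nat \<Rightarrow> real) \<Rightarrow> nat \<Rightarrow> real" where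
  "huber_grad x \<equiv> (\<lambda>i. if i = 0 then min (x 0) 1 else 0)"

lemma norm_1: "norm_d 1 x = \<bar>x 0\<bar>"
  by (simp add: L2_set_def)

lemma has_gradient_huber: "has_gradient 1 (\<lambda>x. huber (x 0)) (huber_grad x) x"
  unfolding has_gradient_def
proof (intro conjI allI impI)
  show "huber_grad x \<in> Rd 1"
    by (simp add: topspace_Euclidean_space)
  fix \<epsilon> :: real assume "\<epsilon> > 0"
  \<comment> \<open>The error is at most the squared distance, so \<delta> = \<epsilon>
    works.\<close>
  have "\<bar>huber (y 0) - huber (x 0) - inner_d 1 (huber_grad x) (minus_d y x)\<bar>
      \<le> \<epsilon> * norm_d 1 (minus_d y x)" if "norm_d 1 (minus_d y x) < \<epsilon>" for y
  proof -
    have "\<bar>huber (y 0) - huber (x 0) - min (x 0) 1 * (y 0 - x 0)\<bar> \<le> \<bar>y 0 - x 0\<bar> * \<bar>y 0 - x 0\<bar>"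
      using huber_above_tangent[of "x 0" "y 0"] huber_below_parabola[of "y 0" "x 0"]
      by (simp add: power2_eq_square)
    also have "\<dots> \<le> \<epsilon> * \<bar>y 0 - x 0\<bar>"
      using that unfolding norm_1 by (intro mult_right_mono) auto
    finally show ?thesis
      unfolding norm_1 by (simp add: inner_d_def)
  qed
  with \<open>\<epsilon> > 0\<close> show "\<exists>\<delta>>0. \<forall>y\<in>Rd 1. norm_d 1 (minus_d y x) < \<delta> \<longrightarrow>
      \<bar>huber (y 0) - huber (x 0) - inner_d 1 (huber_grad x) (minus_d y x)\<bar>
        \<le> \<epsilon> * norm_d 1 (minus_d y x)"
    by blast
qed

lemma gradient_huber:
  "x \<in> Rd 1 \<Longrightarrow> gradient 1 (\<lambda>x. huber (x 0)) x = huber_grad x"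
  by (rule gradient_eqI[OF _ has_gradient_huber])

lemma zero_minimizes_huber: "(\<lambda>_. 0) \<in> minimizers 1 (\<lambda>x. huber (x 0))"
  using huber_nonneg
  by (simp add: minimizers_def is_arg_min_linorder topspace_Euclidean_space huber_def[of 0])

lemma huber_in_F1: "(\<lambda>x. huber (x 0)) \<in> F1 1"
proof -
  have "convex_d 1 (\<lambda>x. huber (x 0))"
    unfolding convex_d_def
  proof (intro ballI)
    fix x y :: "nat \<Rightarrow> real" and t :: real assume t: "t \<in> {0..1}"
    \<comment> \<open>Average the tangent inequalities based at \<open>z\<close>: the linear terms
      cancel by the choice of \<open>z\<close>.\<close>
    define z where "z = (1 - t) * x 0 + t * y 0"
    have "(1 - t) * (huber z + min z 1 * (x 0 - z)) + t * (huber z + min z 1 * (y 0 - z))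
        \<le> (1 - t) * huber (x 0) + t * huber (y 0)"
      using t by (intro add_mono mult_left_mono huber_above_tangent) auto
    moreover have "(1 - t) * (huber z + min z 1 * (x 0 - z)) + t * (huber z + min z 1 * (y 0 - z))
        = huber z + min z 1 * ((1 - t) * x 0 + t * y 0 - z)"
      by algebra
    ultimately show "huber ((1 - t) * x 0 + t * y 0) \<le> (1 - t) * huber (x 0) + t * huber (y 0)"
      by (simp add: z_def)
  qed
  moreover have "one_smooth 1 (\<lambda>x. huber (x 0))"
    unfolding one_smooth_def norm_1 using has_gradient_huber
    by (auto simp: gradient_huber simp del: One_nat_def)
  ultimately show ?thesis
    using zero_minimizes_huber by (auto simp: F1_def)
qed

lemma gd_huber:
  assumes \<eta>: "\<forall>k\<ge>1. \<eta> k > 0" and "k \<le> n"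
  shows "gd 1 (\<lambda>x. huber (x 0)) \<eta> (\<lambda>i. if i = 0 then 1 + (\<Sum>j=1..n. \<eta> j) else 0) k
    = (\<lambda>i. if i = 0 then 1 + (\<Sum>j=Suc k..n. \<eta> j) else 0)"
  using \<open>k \<le> n\<close>
proof (induction k)
  case 0
  show ?case by (simp only: gd.simps One_nat_def)
next
  case (Suc k)
  have "(\<Sum>j=Suc k..n. \<eta> j) = \<eta> (Suc k) + (\<Sum>j=Suc (Suc k)..n. \<eta> j)"
    using Suc.prems by (rule sum.atLeast_Suc_atMost)
  moreover have "(\<Sum>j=Suc k..n. \<eta> j) \<ge> 0"
    using \<eta> by (intro sum_nonneg) (simp add: less_imp_le)
  ultimately show ?case
    using Suc by (auto simp: gradient_huber topspace_Euclidean_space simp del: One_nat_def)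
qed

text \<open>Here \<open>n\<close> only fixes the starting point while \<open>m\<close> counts the
  steps, so that both \<open>m = n\<close> and \<open>m = Suc n\<close> are covered.\<close>

lemma worst_case_rate_ge_huber:
  fixes n m :: nat
  assumes \<eta>: "\<forall>k\<ge>1. \<eta> k > 0"
  defines "x1 \<equiv> (\<lambda>i. if i = 0 then 1 + (\<Sum>j=1..n. \<eta> j) else 0)"
  defines "x \<equiv> gd 1 (\<lambda>x. huber (x 0)) \<eta> x1 m"
  assumes x: "x \<in> Rd 1"
  shows "worst_case_rate \<eta> m \<ge> ereal ((min (x 0) 1)\<^sup>2 / (2 * (\<Sum>j=1..n. \<eta> j) + 1))"
proof -
  let ?f = "\<lambda>x::nat \<Rightarrow> real. huber (x 0)" and ?S = "\<Sum>j=1..n. \<eta> j"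
  have S: "?S \<ge> 0"
    using \<eta> by (intro sum_nonneg) (simp add: less_imp_le)
  have f1: "?f x1 = ?S + 1/2"
    using S by (auto simp: huber_def x1_def)
  have x1: "x1 \<in> Rd 1 - minimizers 1 ?f"
  proof
    show "x1 \<in> Rd 1" by (simp add: x1_def topspace_Euclidean_space)
    have "?f (\<lambda>_. 0) < ?f x1" using S unfolding f1 by (simp add: huber_def)
    moreover have "(\<lambda>_. 0) \<in> Rd 1" by (simp add: topspace_Euclidean_space)
    ultimately show "x1 \<notin> minimizers 1 ?f"
      unfolding minimizers_def is_arg_min_def by blast
  qed
  have "ereal ((1/2 * (norm_d 1 (gradient 1 ?f x))\<^sup>2) / (?f x1 - ?f (\<lambda>_. 0)))
      \<le> worst_case_rate \<eta> m"
    unfolding worst_case_rate_def x_def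
    by (rule SUP_upper2[where i = 1], simp, rule SUP_upper2[OF huber_in_F1],
        rule SUP_upper2[OF zero_minimizes_huber], rule SUP_upper2[OF x1], rule order_refl)
  moreover have "(1/2 * (norm_d 1 (gradient 1 ?f x))\<^sup>2) / (?f x1 - ?f (\<lambda>_. 0))
      = (min (x 0) 1)\<^sup>2 / (2 * ?S + 1)"
    unfolding norm_1 gradient_huber[OF x] f1 using S by (simp add: huber_def field_simps)
  ultimately show ?thesis by simp
qed

lemma worst_case_rate_ge_slow:
  assumes \<eta>: "\<forall>k\<ge>1. \<eta> k > 0"
  shows "worst_case_rate \<eta> n \<ge> ereal (1 / (2 * (\<Sum>j=1..n. \<eta> j) + 1))"
  using worst_case_rate_ge_huber[where \<eta> = \<eta> and n = n and m = n, OF \<eta>]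
  unfolding gd_huber[OF \<eta> order_refl] by (simp add: topspace_Euclidean_space)

lemma worst_case_rate_ge_overshoot:
  assumes \<eta>: "\<forall>k\<ge>1. \<eta> k > 0"
  shows "worst_case_rate \<eta> (Suc n) \<ge> ereal ((1 - \<eta> (Suc n))\<^sup>2 / (2 * (\<Sum>j=1..n. \<eta> j) + 1))"
proof -
  have "gd 1 (\<lambda>x. huber (x 0)) \<eta> (\<lambda>i. if i = 0 then 1 + (\<Sum>j=1..n. \<eta> j) else 0) (Suc n)
      = (\<lambda>i. if i = 0 then 1 - \<eta> (Suc n) else 0)"
    unfolding gd.simps gd_huber[OF \<eta> order_refl]
    by (auto simp: gradient_huber topspace_Euclidean_space simp del: One_nat_def)
  \<comment> \<open>The overshoot lands in the quadratic branch, where the gradient is the iterate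
    itself.\<close>
  moreover have "min (1 - \<eta> (Suc n)) 1 = 1 - \<eta> (Suc n)"
    using \<eta> by simp
  ultimately show ?thesis
    using worst_case_rate_ge_huber[where \<eta> = \<eta> and n = n and m = "Suc n", OF \<eta>]
    by (simp add: topspace_Euclidean_space)
qed

theorem theorem1p2:
  shows "\<not> (\<exists>\<eta> :: nat \<Rightarrow> real. (\<forall>k\<ge>1. \<eta> k > 0) \<and>
            (\<lambda>n. ereal (real n) * worst_case_rate \<eta> n) \<longlonglongrightarrow> 0)"
proof
  assume "\<exists>\<eta> :: nat \<Rightarrow> real. (\<forall>k\<ge>1. \<eta> k > 0) \<and>
            (\<lambda>n. ereal (real n) * worst_case_rate \<eta> n) \<longlonglongrightarrow> 0"
  then obtain \<eta> :: "nat \<Rightarrow> real" where \<eta>: "\<forall>k\<ge>1. \<eta> k > 0"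
    and lim: "(\<lambda>n. ereal (real n) * worst_case_rate \<eta> n) \<longlonglongrightarrow> 0"
    by blast
  define S where "S n = (\<Sum>j=1..n. \<eta> j)" for n
  have S_nonneg: "S n \<ge> 0" for n
    unfolding S_def using \<eta> by (intro sum_nonneg) (simp add: less_imp_le)
  have S_Suc: "S (Suc n) = S n + \<eta> (Suc n)" for n
    by (simp add: S_def)
  \<comment> \<open>Testing against real lower bounds \<open>r\<close> turns the limit in the
    extended reals into real inequalities, whether or not the rate is finite.\<close>
  have small: "\<forall>\<^sub>F n in sequentially. \<forall>r. ereal r \<le> worst_case_rate \<eta> n \<longrightarrow> real n * r < c"
    if "c > 0" for c
  proof -
    have "\<forall>\<^sub>F n in sequentially. ereal (real n) * worst_case_rate \<eta> n < ereal c"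
      using lim that by (intro order_tendstoD(2)[OF lim]) simp
    then show ?thesis
    proof eventually_elim
      case (elim n)
      show ?case
      proof (intro allI impI)
        fix r assume "ereal r \<le> worst_case_rate \<eta> n"
        then have "ereal (real n) * ereal r \<le> ereal (real n) * worst_case_rate \<eta> n"
          by (intro ereal_mult_left_mono) simp_all
        with elim have "ereal (real n) * ereal r < ereal c" by (rule le_less_trans[rotated])
        then show "real n * r < c" by simp
      qed
    qed
  qed
  have average_large: "\<forall>\<^sub>F n in sequentially. S n > M * real n" if "M \<ge> 0" for M
  proof -
    \<comment> \<open>This threshold yields \<open>n * (2 * M + 1) < 2 * S n + 1\<close>; the
      surplus \<open>n\<close> on the left absorbs the 1 once \<open>n\<close> is at least
      1.\<close>
    have "1 / (2 * M + 1) > 0" using that by simp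
    from small[OF this] eventually_ge_at_top[of 1] show ?thesis
    proof eventually_elim
      case (elim n)
      have "real n * (1 / (2 * S n + 1)) < 1 / (2 * M + 1)"
        using elim(1) worst_case_rate_ge_slow[of \<eta> n] \<eta> unfolding S_def by blast
      then have "real n * (2 * M + 1) < 2 * S n + 1"
        using S_nonneg[of n] that by (simp add: field_simps)
      with elim(2) show ?case by (simp add: algebra_simps)
    qed
  qed
  have "\<forall>\<^sub>F n in sequentially. (real n + 1) * (1 - \<eta> (Suc n))\<^sup>2 < 2 * S n + 1"
  proof -
    have "\<forall>\<^sub>F n in sequentially. \<forall>r. ereal r \<le> worst_case_rate \<eta> (Suc n) \<longrightarrow> real (Suc n) * r < 1"
      by (rule eventually_sequentially_Suc[THEN iffD2, OF small]) simp
    then show ?thesis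
    proof eventually_elim
      case (elim n)
      have "real (Suc n) * ((1 - \<eta> (Suc n))\<^sup>2 / (2 * S n + 1)) < 1"
        using elim worst_case_rate_ge_overshoot[of \<eta> n] \<eta> unfolding S_def by blast
      then show ?case
        using S_nonneg[of n] by (simp add: field_simps)
    qed
  qed
  \<comment> \<open>The constant 4 is where \<open>(1 - e)\<^sup>2\<close> overtakes
    \<open>2 * e + 1\<close>: their difference is \<open>e * (e - 4)\<close>.\<close>
  from eventually_conj[OF this average_large[of 4]]
  obtain N0 where N0: "\<And>n. n \<ge> N0 \<Longrightarrow> (real n + 1) * (1 - \<eta> (Suc n))\<^sup>2 < 2 * S n + 1"
      "\<And>n. n \<ge> N0 \<Longrightarrow> S n > 4 * real n"
    by (auto simp: eventually_sequentially)
  define N where "N = max N0 1"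
  have step_le_average: "real n * \<eta> (Suc n) \<le> S n" if "n \<ge> N" for n
  proof (rule ccontr)
    let ?e = "\<eta> (Suc n)"
    assume less: "\<not> real n * ?e \<le> S n"
    have n: "n \<ge> N0" "real n > 0" using that by (auto simp: N_def)
    have "4 * real n < ?e * real n"
      using N0(2)[OF n(1)] less by (simp add: mult.commute)
    then have e: "?e > 4" using n(2) by simp
    have "?e * (?e - 4) > 0" using e by simp
    then have "(1 - ?e)\<^sup>2 \<ge> 2 * ?e + 1"
      by (simp add: power2_eq_square algebra_simps)
    then have "(real n + 1) * (2 * ?e + 1) \<le> (real n + 1) * (1 - ?e)\<^sup>2"
      by (intro mult_left_mono) auto
    also have "\<dots> < 2 * (real n * ?e) + 1"
      using N0(1)[OF n(1)] less by linarith
    finally show False using n e by (simp add: algebra_simps)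
  qed
  \<comment> \<open>A step that is at most the current average cannot raise it, so the average at
    \<open>N\<close> bounds all later ones, against \<open>average_large\<close>.\<close>
  define K where "K = S N / real N"
  have "S n \<le> K * real n" if "n \<ge> N" for n
    using that
  proof (induction n rule: dec_induct)
    case base
    show ?case by (simp add: K_def N_def)
  next
    case (step n)
    have n: "real n > 0" using step.hyps by (simp add: N_def)
    have "real n * \<eta> (Suc n) \<le> real n * K"
      using step_le_average[OF step.hyps(1)] step.IH by (simp add: mult.commute)
    then have "\<eta> (Suc n) \<le> K" using n by simp
    with step.IH show ?case by (simp add: S_Suc algebra_simps)
  qed
  moreover have "K \<ge> 0" using S_nonneg[of N] by (simp add: K_def)
  then obtain N1 where "\<And>n. n \<ge> N1 \<Longrightarrow> S n > K * real n"
    using average_large[of K] by (auto simp: eventually_sequentially)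
  ultimately show False
    by (meson max.cobounded1 max.cobounded2 not_le)
qed

end
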